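(* Let $d\ge1$, $T\in[-\infty,\infty)$, let $\delta>0$ and $F_0$ be constants. Assume the following. (i) On $\mathbb R^{d+1}_T$ we are given real measurable functions $a^{ij},b^i,c,f$ ($i,j=1,\dots,d$) such that the matrix $(a^{ij}(t,x))$ is symmetric and nonnegative, $c(t,x)\ge\delta$, $-f(t,x)\le F_0c(t,x)$, and $$|a(t,x)|\le K(t)(1+|x|^2),\qquad |b(t,x)|\le K(t)(1+|x|)$$ in $\mathbb R^{d+1}_T$, where $K(t)$ is a locally bounded function on $\mathbb R$. Set $Lu=a^{ij}u_{x^ix^j}+b^iu_{x^i}-cu$. (ii) For any $x$, the functions $c(t,x)$ and $f(t,x)$ are locally integrable in $t$ (over bounded intervals contained in $[T,\infty)$, respectively in $\mathbb R$ if $T=-\infty$). (iii) In $\mathbb R^{d+1}_T$ we are given a bounded continuous function $u(t,x)$ which is twice continuously differentiable in $x$ for each finite $t\ge T$ and such that $u_x$ and $u_{xx}$ are continuous with respect to $(t,x)$ in $\mathbb R^{d+1}_T$. (iv) For each $x\in\mathbb R^d$ and all finite $t>s$ with $s\ge T$, $$u(t,x)-u(s,x)=\int_s^t f(r,x)\,dr-\int_s^t Lu(r,x)\,dr.$$ Then $u(t,x)\le F_0$ in $\mathbb R^{d+1}_T$. Furthermore, if $|f(t,x)|\le F_0c(t,x)$ in $\mathbb R^{d+1}_T$, then $|u(t,x)|\le F_0$ in $\mathbb R^{d+1}_T$.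
   Context: $\mathbb R^{d+1}_T=[T,\infty)\times\mathbb R^d$ (points $(t,x)$ with $t\ge T$, $x\in\mathbb R^d$) if $T\in(-\infty,\infty)$, and $\mathbb R^{d+1}_{-\infty}=\mathbb R\times\mathbb R^d$. Summation over repeated indices is understood; $u_x$ and $u_{xx}$ denote the gradient and Hessian in $x$; $a=(a^{ij})$, $b=(b^1,\dots,b^d)$. No continuity of the coefficients or of $f$ is assumed. *)

theory Defs
  imports "HOL-Analysis.Analysis"
begin

text \<open>The dimension \<open>d \<ge> 1\<close> is \<open>CARD('n)\<close>. Points \<open>(t, x)\<close> are pairs, so that joint
  measurability and joint continuity are the library notions on \<open>real \<times> (real ^ 'n)\<close>.\<close>

text \<open>For \<open>T = -\<infinity>\<close> this is the whole space.\<close>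

definition strip :: "ereal \<Rightarrow> (real \<times> (real ^ 'n)) set" where
  "strip T = {(t, x). T \<le> ereal t}"

text \<open>\<open>u\<^sub>x\<close> and \<open>u\<^sub>x\<^sub>x\<close>, differentiating in \<open>x\<close> only. The values are the partial derivatives
  wherever \<open>u(t, \<cdot>)\<close>, respectively \<open>u\<^sub>x(t, \<cdot>)\<close>, is differentiable; this has to be assumed
  separately.\<close>

definition grad_x :: "(real \<times> (real ^ 'n) \<Rightarrow> real) \<Rightarrow> real \<times> (real ^ 'n) \<Rightarrow> real ^ 'n" where
  "grad_x u = (\<lambda>(t, x). \<chi> i. frechet_derivative (\<lambda>y. u (t, y)) (at x) (axis i 1))"

definition hess_x :: "(real \<times> (real ^ 'n) \<Rightarrow> real) \<Rightarrow> real \<times> (real ^ 'n) \<Rightarrow> real ^ 'n ^ 'n" where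
  "hess_x u p = (\<chi> i j. grad_x (\<lambda>q. grad_x u q $ i) p $ j)"

definition L_op ::
  "(real \<times> (real ^ 'n) \<Rightarrow> real ^ 'n ^ 'n) \<Rightarrow> (real \<times> (real ^ 'n) \<Rightarrow> real ^ 'n) \<Rightarrow>
   (real \<times> (real ^ 'n) \<Rightarrow> real) \<Rightarrow> (real \<times> (real ^ 'n) \<Rightarrow> real) \<Rightarrow> real \<times> (real ^ 'n) \<Rightarrow> real" where
  "L_op a b c u p =
     (\<Sum>i\<in>UNIV. \<Sum>j\<in>UNIV. a p $ i $ j * hess_x u p $ i $ j)
     + (\<Sum>i\<in>UNIV. b p $ i * grad_x u p $ i) - c p * u p"

end

theory Submission
  imports Defs "HOL-Real_Asymp.Real_Asymp"
begin

text \<open>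
  Put \<open>w = u - F\<^sub>0\<close>. The equation and \<open>-f \<le> F\<^sub>0 c\<close> say that, for fixed \<open>x\<close>, the function
  \<open>w(\<cdot>, x)\<close> is the integral of a rate that is at least \<open>c w - a : w\<^sub>x\<^sub>x - b \<bullet> w\<^sub>x\<close>. At a spatial
  maximum the two derivative terms have the favourable sign or vanish, and so a positive
  spatial maximum grows in time at least like \<open>exp (\<delta> t)\<close>. This contradicts the boundedness
  of \<open>w\<close>.

  Two points need care. The space is unbounded, so a maximum need not be attained; therefore
  \<open>w\<close> is compared on \<open>[t\<^sub>0, t\<^sub>1] \<times> \<real>\<^sup>d\<close> with the barrier
  \<open>\<psi>(t, x) = N exp (- \<delta> (t\<^sub>1 - t)) + \<epsilon> exp (- \<mu> (t - t\<^sub>0)) (1 + |x|\<^sup>2)\<close>,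
  where \<open>N\<close> bounds \<open>w\<close>. The second summand makes \<open>w - \<psi>\<close> negative for large \<open>x\<close>; by the growth
  bounds on \<open>a\<close> and \<open>b\<close>, its contribution to the second- and first-order terms is at most
  \<open>\<mu>\<close> times itself for a suitable \<open>\<mu>\<close>, and the decay in time pays for that. The first
  summand equals \<open>N\<close> at \<open>t = t\<^sub>1\<close>, so \<open>w - \<psi>\<close> is negative there. Hence a positive maximum of \<open>w - \<psi>\<close> would sit at
  some \<open>(s, x)\<close> with \<open>s < t\<^sub>1\<close>.

  The coefficients are only measurable, and the equation holds at almost every time with an
  exceptional set depending on \<open>x\<close>, so it cannot be evaluated at \<open>(s, x)\<close> itself. Instead \<open>x\<close>
  is frozen and the equation is integrated forward from \<open>s\<close> (lemma
  \<open>difference_to_barrier_increases\<close>): \<open>w\<close>, \<open>w\<^sub>x\<close>, \<open>w\<^sub>x\<^sub>x\<close> are continuous in time and the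
  coefficients \<open>a(r, x)\<close>, \<open>b(r, x)\<close> are bounded, so for \<open>r\<close> close to \<open>s\<close> the rate at \<open>(r, x)\<close> is nearly bounded
  below by what the maximum conditions at \<open>(s, x)\<close> give (lemma \<open>rate_lower_bound\<close>). It follows
  that \<open>w - \<psi>\<close> is larger at \<open>(t, x)\<close> for some \<open>t > s\<close>, a contradiction. Thus \<open>w \<le> \<psi>\<close>, and
  \<open>\<epsilon> \<rightarrow> 0\<close>, \<open>t\<^sub>1 \<rightarrow> \<infinity>\<close> yield \<open>w \<le> 0\<close>. The two-sided estimate follows by the same argument for
  \<open>-u - F\<^sub>0\<close>.
\<close>

section \<open>Contraction of quadratic forms\<close>

text \<open>
  A positive semidefinite form is a sum of squares of linear forms, and contracting \<open>B\<close> with a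
  single square \<open>\<xi>\<^sub>i \<xi>\<^sub>j\<close> gives \<open>B(\<xi>, \<xi>) \<ge> 0\<close>. The induction completes one square at a time: the
  row of \<open>k\<close> is removed from \<open>A\<close> by passing to its Schur complement \<open>A'\<close>. This avoids
  diagonalising \<open>A\<close>.
\<close>

lemma psd_form_contraction_nonneg:
  fixes A B :: "'i \<Rightarrow> 'i \<Rightarrow> real"
  assumes "finite S"
    and "\<And>i j. i \<in> S \<Longrightarrow> j \<in> S \<Longrightarrow> A i j = A j i"
    and "\<And>\<xi>. 0 \<le> (\<Sum>i\<in>S. \<Sum>j\<in>S. A i j * (\<xi> i * \<xi> j))"
    and "\<And>\<xi>. 0 \<le> (\<Sum>i\<in>S. \<Sum>j\<in>S. B i j * (\<xi> i * \<xi> j))"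
  shows "0 \<le> (\<Sum>i\<in>S. \<Sum>j\<in>S. A i j * B i j)"
  using assms
proof (induction S arbitrary: A rule: finite_induct)
  case empty
  show ?case by simp
next
  case (insert k S)
  note sym = insert.prems(1) and A_psd = insert.prems(2) and B_psd = insert.prems(3)
  have split: "(\<Sum>i\<in>insert k S. \<Sum>j\<in>insert k S. G i j) =
      G k k + (\<Sum>j\<in>S. G k j) + (\<Sum>i\<in>S. G i k) + (\<Sum>i\<in>S. \<Sum>j\<in>S. G i j)" for G :: "'i \<Rightarrow> 'i \<Rightarrow> real"
    using insert.hyps by (simp add: sum.distrib)
  have form: "0 \<le> A k k * \<tau>\<^sup>2 + 2 * \<tau> * (\<Sum>j\<in>S. A k j * \<xi> j) + (\<Sum>i\<in>S. \<Sum>j\<in>S. A i j * (\<xi> i * \<xi> j))"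
    for \<xi> \<tau>
  proof -
    define \<zeta> where "\<zeta> = \<xi>(k := \<tau>)"
    have \<zeta>: "\<zeta> k = \<tau>" "\<And>i. i \<in> S \<Longrightarrow> \<zeta> i = \<xi> i"
      using insert.hyps by (auto simp: \<zeta>_def)
    have "(\<Sum>j\<in>S. A k j * (\<zeta> k * \<zeta> j)) = \<tau> * (\<Sum>j\<in>S. A k j * \<xi> j)"
      unfolding sum_distrib_left by (rule sum.cong) (auto simp: \<zeta>)
    moreover have "(\<Sum>i\<in>S. A i k * (\<zeta> i * \<zeta> k)) = \<tau> * (\<Sum>j\<in>S. A k j * \<xi> j)"
      unfolding sum_distrib_left by (rule sum.cong) (auto simp: \<zeta> sym)
    moreover have "(\<Sum>i\<in>S. \<Sum>j\<in>S. A i j * (\<zeta> i * \<zeta> j)) = (\<Sum>i\<in>S. \<Sum>j\<in>S. A i j * (\<xi> i * \<xi> j))"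
      by (intro sum.cong) (auto simp: \<zeta>)
    ultimately show ?thesis
      using A_psd[of \<zeta>] unfolding split by (simp add: \<zeta> power2_eq_square algebra_simps)
  qed
  have diag: "0 \<le> A k k"
    using form[of 1 "\<lambda>_. 0"] by simp
  have row0: "A k j = 0" if "A k k = 0" "j \<in> S" for j
  proof (rule ccontr)
    assume ne: "A k j \<noteq> 0"
    define e :: "'i \<Rightarrow> real" where "e = (\<lambda>i. if i = j then 1 else 0)"
    have "(\<Sum>i\<in>S. A k i * e i) = A k j"
      using that insert.hyps by (simp add: e_def if_distrib cong: if_cong)
    \<comment> \<open>With \<open>A k k = 0\<close> the form is affine in \<open>\<tau>\<close>; this \<open>\<tau>\<close> makes it equal to \<open>-1\<close>.\<close>
    with form[of "- (1 + (\<Sum>i\<in>S. \<Sum>l\<in>S. A i l * (e i * e l))) / (2 * A k j)" e] that ne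
    show False by (simp add: field_simps)
  qed
  \<comment> \<open>If the diagonal entry vanishes, so does its row, and the quotient by \<open>0\<close> is \<open>0\<close> as it should be.\<close>
  define A' where "A' i j = A i j - A i k * A k j / A k k" for i j
  have "0 \<le> (\<Sum>i\<in>S. \<Sum>j\<in>S. A' i j * B i j)"
  proof (rule insert.IH)
    show "A' i j = A' j i" if "i \<in> S" "j \<in> S" for i j
      using that by (simp add: A'_def sym mult.commute)
    \<comment> \<open>The Schur complement at \<open>\<xi>\<close> is the minimum of the form of \<open>A\<close> over the \<open>k\<close>-th coordinate,
      attained at \<open>- l / A k k\<close>.\<close>
    show "0 \<le> (\<Sum>i\<in>S. \<Sum>j\<in>S. A' i j * (\<xi> i * \<xi> j))" for \<xi>
    proof -
      define l where "l = (\<Sum>j\<in>S. A k j * \<xi> j)"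
      have l0: "l = 0" if "A k k = 0"
        using row0[OF that] by (simp add: l_def)
      have "(\<Sum>i\<in>S. \<Sum>j\<in>S. A' i j * (\<xi> i * \<xi> j)) =
          (\<Sum>i\<in>S. \<Sum>j\<in>S. A i j * (\<xi> i * \<xi> j)) - (\<Sum>i\<in>S. \<Sum>j\<in>S. (A k i * \<xi> i) * (A k j * \<xi> j)) / A k k"
        unfolding sum_divide_distrib sum_subtractf[symmetric]
        by (intro sum.cong) (auto simp: A'_def sym algebra_simps)
      also have "(\<Sum>i\<in>S. \<Sum>j\<in>S. (A k i * \<xi> i) * (A k j * \<xi> j)) = l\<^sup>2"
        by (simp add: l_def power2_eq_square sum_product)
      finally show ?thesis
        using form[of "- l / A k k" \<xi>] form[of 0 \<xi>] l0
        by (cases "A k k = 0") (simp_all add: l_def[symmetric] power2_eq_square)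
    qed
    show "0 \<le> (\<Sum>i\<in>S. \<Sum>j\<in>S. B i j * (\<xi> i * \<xi> j))" for \<xi>
    proof -
      define \<zeta> where "\<zeta> = \<xi>(k := 0)"
      have \<zeta>: "\<zeta> k = 0" "\<And>i. i \<in> S \<Longrightarrow> \<zeta> i = \<xi> i"
        using insert.hyps by (auto simp: \<zeta>_def)
      have "(\<Sum>i\<in>S. \<Sum>j\<in>S. B i j * (\<zeta> i * \<zeta> j)) = (\<Sum>i\<in>S. \<Sum>j\<in>S. B i j * (\<xi> i * \<xi> j))"
        by (intro sum.cong) (auto simp: \<zeta>)
      then show ?thesis
        using B_psd[of \<zeta>] unfolding split by (simp add: \<zeta>)
    qed
  qed
  also have "(\<Sum>i\<in>S. \<Sum>j\<in>S. A' i j * B i j) = (\<Sum>i\<in>insert k S. \<Sum>j\<in>insert k S. A' i j * B i j)"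
  proof -
    have "A' k j = 0 \<and> A' j k = 0" if "j \<in> insert k S" for j
      using that row0 sym[of j k] by (cases "A k k = 0") (auto simp: A'_def)
    then show ?thesis unfolding split by simp
  qed
  also have "\<dots> = (\<Sum>i\<in>insert k S. \<Sum>j\<in>insert k S. A i j * B i j)
      - (\<Sum>i\<in>insert k S. \<Sum>j\<in>insert k S. B i j * (A i k * A j k)) / A k k"
    unfolding sum_divide_distrib sum_subtractf[symmetric]
    by (intro sum.cong refl) (simp add: A'_def sym algebra_simps)
  finally show ?case
    using B_psd[of "\<lambda>i. A i k"] diag by (smt (verit) divide_nonneg_nonneg)
qed

lemma inner_matrix_vector_eq_sum:
  fixes M :: "real ^ 'n ^ 'n"
  shows "\<xi> \<bullet> (M *v \<xi>) = (\<Sum>i\<in>UNIV. \<Sum>j\<in>UNIV. M $ i $ j * (\<xi> $ i * \<xi> $ j))"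
  by (simp add: inner_vec_def matrix_vector_mult_def sum_distrib_left algebra_simps)

lemma inner_matrix_eq_contraction:
  fixes A M :: "real ^ 'n ^ 'n"
  shows "A \<bullet> M = (\<Sum>i\<in>UNIV. \<Sum>j\<in>UNIV. A $ i $ j * M $ i $ j)"
  by (simp add: inner_vec_def)

text \<open>The matrix \<open>\<kappa> I - H\<close> has a nonnegative form; its contraction with \<open>A\<close> is therefore nonnegative.\<close>

lemma contraction_le_trace:
  fixes A H :: "real ^ 'n ^ 'n"
  assumes sym: "transpose A = A" and psd: "\<And>\<xi>. 0 \<le> \<xi> \<bullet> (A *v \<xi>)"
    and H: "\<And>\<xi>. \<xi> \<bullet> (H *v \<xi>) \<le> \<kappa> * (\<xi> \<bullet> \<xi>)"
  shows "A \<bullet> H \<le> \<kappa> * trace A"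
proof -
  define B where "B i j = (if i = j then \<kappa> else 0) - H $ i $ j" for i j
  have "0 \<le> (\<Sum>i\<in>UNIV. \<Sum>j\<in>UNIV. A $ i $ j * B i j)"
  proof (rule psd_form_contraction_nonneg)
    show "A $ i $ j = A $ j $ i" for i j
      using arg_cong[OF sym, of "\<lambda>M. M $ j $ i"] by (simp add: transpose_def)
    show "0 \<le> (\<Sum>i\<in>UNIV. \<Sum>j\<in>UNIV. A $ i $ j * (\<xi> i * \<xi> j))" for \<xi>
      using psd[of "\<chi> i. \<xi> i"] by (simp add: inner_matrix_vector_eq_sum)
    show "0 \<le> (\<Sum>i\<in>UNIV. \<Sum>j\<in>UNIV. B i j * (\<xi> i * \<xi> j))" for \<xi>
    proof -
      have "B i j * (\<xi> i * \<xi> j) = (if i = j then \<kappa> * (\<xi> i * \<xi> i) else 0) - H $ i $ j * (\<xi> i * \<xi> j)" for i j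
        by (simp add: B_def left_diff_distrib)
      then show ?thesis
        using H[of "\<chi> i. \<xi> i"]
        by (simp only: inner_matrix_vector_eq_sum sum_subtractf)
           (simp add: inner_vec_def sum_distrib_left)
    qed
  qed simp
  moreover have "A $ i $ j * B i j = (if i = j then \<kappa> * A $ i $ i else 0) - A $ i $ j * H $ i $ j" for i j
    by (simp add: B_def right_diff_distrib)
  ultimately show ?thesis
    unfolding inner_matrix_eq_contraction trace_def
    by (simp only: sum_subtractf) (simp add: sum_distrib_left)
qed

lemma trace_le_card_norm:
  fixes A :: "real ^ 'n ^ 'n"
  shows "trace A \<le> CARD('n) * norm A"
proof -
  have "A $ i $ i \<le> norm A" for i
    using component_le_norm_cart[of "A $ i" i] Finite_Cartesian_Product.norm_nth_le[of A i] by linarith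
  then show ?thesis
    unfolding trace_def using sum_bounded_above[of UNIV "\<lambda>i. A $ i $ i" "norm A"] by simp
qed

section \<open>First- and second-order conditions at a maximum\<close>

lemma second_derivative_le_zero_at_max:
  fixes h h' :: "real \<Rightarrow> real"
  assumes deriv: "\<And>\<tau>. (h has_real_derivative h' \<tau>) (at \<tau>)"
    and deriv2: "(h' has_real_derivative l) (at 0)"
    and max: "\<And>\<tau>. h \<tau> \<le> h 0"
  shows "h' 0 = 0" and "l \<le> 0"
proof -
  show h'0: "h' 0 = 0"
    using DERIV_local_max[OF deriv, of 1 0] max by auto
  show "l \<le> 0"
  proof (rule ccontr)
    assume "\<not> l \<le> 0"
    then obtain d where d: "0 < d" "\<And>e. 0 < e \<Longrightarrow> e < d \<Longrightarrow> h' 0 < h' (0 + e)"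
      using DERIV_pos_inc_right[OF deriv2] by auto
    obtain \<sigma> where "0 < \<sigma>" "\<sigma> < d / 2" "h (d / 2) - h 0 = (d / 2 - 0) * h' \<sigma>"
      using MVT2[of 0 "d / 2" h h'] deriv d(1) by auto
    with d h'0 max[of "d / 2"] show False
      by (smt (verit) mult_pos_pos field_sum_of_halves)
  qed
qed

text \<open>
  The maximum conditions are obtained on every line through \<open>x\<close>, from the function \<open>h\<close> of one
  real variable.
\<close>

lemma max_below_paraboloid:
  fixes v :: "real ^ 'n \<Rightarrow> real" and g :: "real ^ 'n \<Rightarrow> real ^ 'n"
  assumes v: "\<And>y. (v has_derivative (\<lambda>\<xi>. g y \<bullet> \<xi>)) (at y)"
    and g: "(g has_derivative (\<lambda>\<xi>. M *v \<xi>)) (at x)"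
    and max: "\<And>y. v y - E * (y \<bullet> y) \<le> v x - E * (x \<bullet> x)"
  shows "g x = (2 * E) *\<^sub>R x" and "\<xi> \<bullet> (M *v \<xi>) \<le> 2 * E * (\<xi> \<bullet> \<xi>)"
proof -
  define h where "h \<xi> \<tau> = v (x + \<tau> *\<^sub>R \<xi>) - E * ((x + \<tau> *\<^sub>R \<xi>) \<bullet> (x + \<tau> *\<^sub>R \<xi>))" for \<xi> \<tau>
  define h' where "h' \<xi> \<tau> = g (x + \<tau> *\<^sub>R \<xi>) \<bullet> \<xi> - 2 * E * ((x + \<tau> *\<^sub>R \<xi>) \<bullet> \<xi>)" for \<xi> \<tau>
  have line: "((\<lambda>\<tau>. x + \<tau> *\<^sub>R \<xi>) has_derivative (\<lambda>s. s *\<^sub>R \<xi>)) (at \<tau>)" for \<xi> :: "real ^ 'n" and \<tau>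
    by (auto intro!: derivative_eq_intros)
  have "(h \<xi> has_real_derivative h' \<xi> \<tau>) (at \<tau>)" for \<xi> \<tau>
    unfolding has_field_derivative_def h_def
    by (rule has_derivative_eq_rhs)
       (auto intro!: derivative_eq_intros has_derivative_compose[OF line v] line
         simp: h'_def fun_eq_iff algebra_simps inner_commute)
  moreover have "(h' \<xi> has_real_derivative \<xi> \<bullet> (M *v \<xi>) - 2 * E * (\<xi> \<bullet> \<xi>)) (at 0)" for \<xi>
  proof -
    have "((\<lambda>\<tau>. g (x + \<tau> *\<^sub>R \<xi>)) has_derivative (\<lambda>s. M *v (s *\<^sub>R \<xi>))) (at 0)"
      using has_derivative_compose[OF line[of \<xi> 0], of g] g by simp
    then have "((\<lambda>\<tau>. h' \<xi> \<tau>) has_derivative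
        (\<lambda>s. (M *v (s *\<^sub>R \<xi>)) \<bullet> \<xi> - 2 * E * ((s *\<^sub>R \<xi>) \<bullet> \<xi>))) (at 0)"
      unfolding h'_def
      by (intro has_derivative_diff has_derivative_inner_left has_derivative_mult_right line)
    also have "(\<lambda>s. (M *v (s *\<^sub>R \<xi>)) \<bullet> \<xi> - 2 * E * ((s *\<^sub>R \<xi>) \<bullet> \<xi>)) =
        (*) (\<xi> \<bullet> (M *v \<xi>) - 2 * E * (\<xi> \<bullet> \<xi>))"
      by (auto simp: fun_eq_iff matrix_vector_mult_scaleR inner_commute right_diff_distrib)
         (simp add: algebra_simps)
    finally show ?thesis
      by (simp add: has_field_derivative_def)
  qed
  moreover have "h \<xi> \<tau> \<le> h \<xi> 0" for \<xi> \<tau>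
    using max[of "x + \<tau> *\<^sub>R \<xi>"] by (simp add: h_def)
  ultimately have *: "h' \<xi> 0 = 0" "\<xi> \<bullet> (M *v \<xi>) - 2 * E * (\<xi> \<bullet> \<xi>) \<le> 0" for \<xi>
    using second_derivative_le_zero_at_max[of "h \<xi>" "h' \<xi>"] by blast+
  have "(g x - (2 * E) *\<^sub>R x) \<bullet> \<xi> = 0" for \<xi>
    using *(1)[of \<xi>] by (simp add: h'_def inner_diff_left)
  then show "g x = (2 * E) *\<^sub>R x"
    using inner_eq_zero_iff right_minus_eq by blast
  show "\<xi> \<bullet> (M *v \<xi>) \<le> 2 * E * (\<xi> \<bullet> \<xi>)"
    using *(2)[of \<xi>] by simp
qed

section \<open>The spatial gradient and Hessian as derivatives\<close>

lemma linear_eq_inner_axis: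
  fixes F :: "real ^ 'n \<Rightarrow> real"
  assumes "linear F"
  shows "F \<xi> = (\<chi> i. F (axis i 1)) \<bullet> \<xi>"
proof -
  have "F \<xi> = F (\<Sum>i\<in>UNIV. (\<xi> $ i) *\<^sub>R axis i 1)"
    by (metis (no_types) basis_expansion scalar_mult_eq_scaleR sum.cong)
  also have "\<dots> = (\<Sum>i\<in>UNIV. (\<xi> $ i) * F (axis i 1))"
    by (simp add: linear_sum[OF assms] linear_scale[OF assms])
  finally show ?thesis by (simp add: inner_vec_def mult.commute)
qed

lemma has_derivative_grad_x:
  assumes "(\<lambda>y. u (t, y)) differentiable (at x)"
  shows "((\<lambda>y. u (t, y)) has_derivative (\<lambda>\<xi>. grad_x u (t, x) \<bullet> \<xi>)) (at x)"
proof -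
  define F where "F = frechet_derivative (\<lambda>y. u (t, y)) (at x)"
  have F: "((\<lambda>y. u (t, y)) has_derivative F) (at x)"
    using assms unfolding F_def frechet_derivative_works .
  have "F = (\<lambda>\<xi>. grad_x u (t, x) \<bullet> \<xi>)"
  proof
    show "F \<xi> = grad_x u (t, x) \<bullet> \<xi>" for \<xi>
      using linear_eq_inner_axis[OF has_derivative_linear[OF F], of \<xi>] unfolding grad_x_def F_def
      by simp
  qed
  with F show ?thesis by simp
qed

lemma has_derivative_hess_x:
  assumes "(\<lambda>y. grad_x u (t, y)) differentiable (at x)"
  shows "((\<lambda>y. grad_x u (t, y)) has_derivative (\<lambda>\<xi>. hess_x u (t, x) *v \<xi>)) (at x)"
proof -
  have diff: "(\<lambda>y. grad_x u (t, y) $ i) differentiable (at x)" for i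
    using assms bounded_linear.has_derivative[OF bounded_linear_vec_nth]
    unfolding differentiable_def by blast
  have "((\<lambda>y. grad_x u (t, y) $ i) has_derivative (\<lambda>\<xi>. (hess_x u (t, x) *v \<xi>) $ i)) (at x)" for i
    using has_derivative_grad_x[OF diff[of i]]
    by (simp add: hess_x_def matrix_vector_mult_def inner_vec_def)
  then show ?thesis
    by (subst has_derivative_componentwise_within) (auto simp: Basis_vec_def inner_axis)
qed

section \<open>Comparison with a barrier\<close>

lemma norm_le_one_plus_inner: "norm x \<le> 1 + x \<bullet> x"
proof -
  have "0 \<le> (norm x - 1)\<^sup>2 + norm x" by simp
  then show ?thesis
    by (simp add: power2_norm_eq_inner[symmetric] power2_eq_square algebra_simps)
qed

text \<open>
  The first summand solves \<open>y' = \<delta> y\<close> with value \<open>N\<close> at \<open>t\<^sub>1\<close>, so it grows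
  no faster than a positive spatial maximum of \<open>w\<close>. The second summand confines maxima to bounded sets.
\<close>

definition barrier :: "real \<Rightarrow> real \<Rightarrow> real \<Rightarrow> real \<Rightarrow> real \<Rightarrow> real \<Rightarrow> real \<times> (real ^ 'n) \<Rightarrow> real" where
  "barrier N \<delta> t\<^sub>1 \<epsilon> \<mu> t\<^sub>0 = (\<lambda>(t, x).
     N * exp (- \<delta> * (t\<^sub>1 - t)) + \<epsilon> * exp (- \<mu> * (t - t\<^sub>0)) * (1 + x \<bullet> x))"

text \<open>
  The situation of \<open>w = \<plusminus>u - F\<^sub>0\<close>, stated for abstract \<open>w\<close>, gradient \<open>g\<close>, Hessian \<open>H\<close> and time rate
  \<open>q\<close> so that both signs are instances. The assumption \<open>q_ge\<close> is
  \<open>w\<^sub>t + a : w\<^sub>x\<^sub>x + b \<bullet> w\<^sub>x - c w \<ge> 0\<close>, with \<open>w\<^sub>t\<close> understood in the integrated sense of \<open>w_eq\<close>.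
\<close>

locale backward_subsolution =
  fixes T :: ereal and \<delta> :: real
    and a :: "real \<times> (real ^ 'n) \<Rightarrow> real ^ 'n ^ 'n"
    and b :: "real \<times> (real ^ 'n) \<Rightarrow> real ^ 'n"
    and c :: "real \<times> (real ^ 'n) \<Rightarrow> real"
    and K :: "real \<Rightarrow> real"
    and w :: "real \<times> (real ^ 'n) \<Rightarrow> real"
    and g :: "real \<times> (real ^ 'n) \<Rightarrow> real ^ 'n"
    and H :: "real \<times> (real ^ 'n) \<Rightarrow> real ^ 'n ^ 'n"
    and q :: "real \<times> (real ^ 'n) \<Rightarrow> real"
  assumes delta_pos: "\<delta> > 0"
    and a_sym: "\<And>p. p \<in> strip T \<Longrightarrow> transpose (a p) = a p"
    and a_nonneg: "\<And>p \<xi>. p \<in> strip T \<Longrightarrow> 0 \<le> \<xi> \<bullet> (a p *v \<xi>)"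
    and c_ge: "\<And>p. p \<in> strip T \<Longrightarrow> c p \<ge> \<delta>"
    and K_locally_bounded: "\<And>s t. bounded (K ` {s..t})"
    and a_growth: "\<And>t x. (t, x) \<in> strip T \<Longrightarrow> norm (a (t, x)) \<le> K t * (1 + (norm x)\<^sup>2)"
    and b_growth: "\<And>t x. (t, x) \<in> strip T \<Longrightarrow> norm (b (t, x)) \<le> K t * (1 + norm x)"
    and w_bounded: "bdd_above (w ` strip T)"
    and w_cont: "continuous_on (strip T) w"
    and g_cont: "continuous_on (strip T) g"
    and H_cont: "continuous_on (strip T) H"
    and w_deriv: "\<And>t x. (t, x) \<in> strip T \<Longrightarrow>
                    ((\<lambda>y. w (t, y)) has_derivative (\<lambda>\<xi>. g (t, x) \<bullet> \<xi>)) (at x)"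
    and g_deriv: "\<And>t x. (t, x) \<in> strip T \<Longrightarrow>
                    ((\<lambda>y. g (t, y)) has_derivative (\<lambda>\<xi>. H (t, x) *v \<xi>)) (at x)"
    and q_int: "\<And>x s t. T \<le> ereal s \<Longrightarrow> s < t \<Longrightarrow> (\<lambda>r. q (r, x)) integrable_on {s..t}"
    and w_eq: "\<And>x s t. T \<le> ereal s \<Longrightarrow> s < t \<Longrightarrow>
                 w (t, x) - w (s, x) = integral {s..t} (\<lambda>r. q (r, x))"
    and q_ge: "\<And>p. p \<in> strip T \<Longrightarrow> c p * w p - a p \<bullet> H p - b p \<bullet> g p \<le> q p"
begin

text \<open>
  Bounds on the derivatives are known at \<open>(s, x)\<close>, the coefficients are taken at \<open>(r, x)\<close>. Replacing
  \<open>w\<close> and its derivatives at \<open>r\<close> by those at \<open>s\<close> costs the bracketed error, which for a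
  fixed \<open>k\<close> vanishes as \<open>r \<rightarrow> s\<close> by continuity. In the factor \<open>2 d + 4\<close>, the part \<open>2 d\<close> comes from the trace of \<open>a\<close>
  and \<open>4\<close> from the drift, through \<open>(1 + |x|) |x| \<le> 2 (1 + |x|\<^sup>2)\<close>.
\<close>

lemma rate_lower_bound:
  fixes k E :: real
  assumes s: "(s, x) \<in> strip T" and r: "(r, x) \<in> strip T"
    and k: "K r \<le> k" and E: "0 \<le> E" and w_nonneg: "0 \<le> w (r, x)"
    and grad: "g (s, x) = (2 * E) *\<^sub>R x"
    and hess: "\<And>\<xi>. \<xi> \<bullet> (H (s, x) *v \<xi>) \<le> 2 * E * (\<xi> \<bullet> \<xi>)"
  shows "\<delta> * w (s, x) - (2 * real CARD('n) + 4) * k * (E * (1 + x \<bullet> x))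
     - (k * (1 + x \<bullet> x) * norm (H (r, x) - H (s, x)) + k * (1 + norm x) * norm (g (r, x) - g (s, x))
        + \<delta> * \<bar>w (r, x) - w (s, x)\<bar>) \<le> q (r, x)"
proof -
  have na: "norm (a (r, x)) \<le> k * (1 + x \<bullet> x)"
    using a_growth[OF r] mult_right_mono[OF k, of "1 + x \<bullet> x"] by (simp add: power2_norm_eq_inner)
  have nb: "norm (b (r, x)) \<le> k * (1 + norm x)"
    using b_growth[OF r] mult_right_mono[OF k, of "1 + norm x"] by simp
  have "0 \<le> k * (1 + norm x)" using nb norm_ge_zero by (rule order_trans[rotated])
  then have k0: "0 \<le> k" by (smt (verit) zero_le_mult_iff norm_ge_zero)
  have "\<delta> * w (r, x) \<le> c (r, x) * w (r, x)"
    using c_ge[OF r] w_nonneg by (rule mult_right_mono)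
  moreover have "\<delta> * w (s, x) - \<delta> * \<bar>w (r, x) - w (s, x)\<bar> \<le> \<delta> * w (r, x)"
    using delta_pos by (simp add: right_diff_distrib[symmetric])
  moreover have "a (r, x) \<bullet> H (s, x) \<le> 2 * CARD('n) * k * (E * (1 + x \<bullet> x))"
  proof -
    have "a (r, x) \<bullet> H (s, x) \<le> 2 * E * trace (a (r, x))"
      by (rule contraction_le_trace[OF a_sym[OF r] a_nonneg[OF r] hess])
    also have "\<dots> \<le> 2 * E * (CARD('n) * (k * (1 + x \<bullet> x)))"
      using E na order_trans[OF trace_le_card_norm mult_left_mono[OF na]]
      by (intro mult_left_mono) auto
    finally show ?thesis by (simp add: algebra_simps)
  qed
  moreover have "a (r, x) \<bullet> (H (r, x) - H (s, x)) \<le> k * (1 + x \<bullet> x) * norm (H (r, x) - H (s, x))"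
    using norm_cauchy_schwarz na by (rule order_trans[OF _ mult_right_mono]) simp
  moreover have "b (r, x) \<bullet> g (s, x) \<le> 4 * k * (E * (1 + x \<bullet> x))"
  proof -
    have "b (r, x) \<bullet> x \<le> k * (1 + norm x) * norm x"
      using norm_cauchy_schwarz nb by (rule order_trans[OF _ mult_right_mono]) simp
    also have "\<dots> = k * ((1 + norm x) * norm x)" by simp
    also have "(1 + norm x) * norm x \<le> 2 * (1 + x \<bullet> x)"
      using norm_le_one_plus_inner[of x] by (simp add: distrib_right power2_norm_eq_inner[symmetric] power2_eq_square)
    finally have "b (r, x) \<bullet> x \<le> k * (2 * (1 + x \<bullet> x))"
      using k0 by (simp add: mult_left_mono)
    then have "(2 * E) * (b (r, x) \<bullet> x) \<le> (2 * E) * (k * (2 * (1 + x \<bullet> x)))"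
      using E by (intro mult_left_mono) auto
    then show ?thesis by (simp add: grad algebra_simps)
  qed
  moreover have "b (r, x) \<bullet> (g (r, x) - g (s, x)) \<le> k * (1 + norm x) * norm (g (r, x) - g (s, x))"
    using norm_cauchy_schwarz nb by (rule order_trans[OF _ mult_right_mono]) simp
  ultimately show ?thesis
    using q_ge[OF r] by (simp add: inner_diff_right distrib_right) 
qed

lemma in_strip_later: "(s, x) \<in> strip T \<Longrightarrow> s \<le> t \<Longrightarrow> (t, y) \<in> strip T"
  by (auto simp: strip_def intro: order_trans)

lemma continuous_on_time_section:
  assumes "continuous_on (strip T) h" "(s, x) \<in> strip T"
  shows "continuous_on {s..t} (\<lambda>r. h (r, x))"
  using assms(2) in_strip_later
  by (intro continuous_on_compose2[OF assms(1)]) (auto intro!: continuous_intros)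

text \<open>
  A spatial maximum point of \<open>w - \<psi>\<close> with positive value is not a maximum in time: staying at the
  same \<open>x\<close>, the difference becomes larger at once. The choice of \<open>\<mu>\<close> cancels the
  contribution of the quadratic part of the barrier exactly; what is left is
  \<open>\<delta> (w - \<psi>)\<close> plus \<open>\<delta>\<close> times that quadratic part, and half of the latter absorbs the continuity
  error \<open>\<Theta>\<close>.
\<close>

lemma difference_to_barrier_increases:
  fixes \<epsilon> \<mu> N t\<^sub>0 t\<^sub>1 k :: real
  defines "\<psi> \<equiv> barrier N \<delta> t\<^sub>1 \<epsilon> \<mu> t\<^sub>0"
  assumes s: "(s, x) \<in> strip T" and "s < t\<^sub>1" and "0 < \<epsilon>" and "0 \<le> N"
    and k: "\<And>r. r \<in> {s..t\<^sub>1} \<Longrightarrow> K r \<le> k" and \<mu>: "\<mu> = (2 * real CARD('n) + 4) * k"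
    and above: "\<psi> (s, x) < w (s, x)"
    and max: "\<And>y. w (s, y) - \<psi> (s, y) \<le> w (s, x) - \<psi> (s, x)"
  shows "\<exists>t\<in>{s<..t\<^sub>1}. w (s, x) - \<psi> (s, x) < w (t, x) - \<psi> (t, x)"
proof -
  define E where "E = \<epsilon> * exp (- \<mu> * (s - t\<^sub>0))"
  define \<phi> where "\<phi> = 1 + x \<bullet> x"
  have E: "0 < E" using \<open>0 < \<epsilon>\<close> by (simp add: E_def)
  have \<phi>: "0 < \<phi>" by (simp add: \<phi>_def add_pos_nonneg)
  have w_pos: "0 < w (s, x)"
  proof -
    have "0 \<le> \<psi> (s, x)" using \<open>0 \<le> N\<close> \<open>0 < \<epsilon>\<close> by (simp add: \<psi>_def barrier_def)
    with above show ?thesis by simp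
  qed
  have "w (s, y) - E * (y \<bullet> y) \<le> w (s, x) - E * (x \<bullet> x)" for y
    using max[of y] by (simp add: \<psi>_def barrier_def E_def algebra_simps)
  note at_max = max_below_paraboloid[OF w_deriv[OF in_strip_later[OF s order_refl]] g_deriv[OF s] this]
  define \<Theta> where "\<Theta> r = k * (1 + x \<bullet> x) * norm (H (r, x) - H (s, x))
      + k * (1 + norm x) * norm (g (r, x) - g (s, x)) + \<delta> * \<bar>w (r, x) - w (s, x)\<bar>" for r
  have "continuous_on {s..t\<^sub>1} \<Theta>"
    unfolding \<Theta>_def by (intro continuous_intros continuous_on_time_section[OF _ s] w_cont g_cont H_cont)
  moreover have "continuous_on {s..t\<^sub>1} (\<lambda>r. w (r, x))"
    by (rule continuous_on_time_section[OF w_cont s])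
  ultimately have lims: "(\<Theta> \<longlongrightarrow> \<Theta> s) (at s within {s..t\<^sub>1})" "((\<lambda>r. w (r, x)) \<longlongrightarrow> w (s, x)) (at s within {s..t\<^sub>1})"
    using \<open>s < t\<^sub>1\<close> by (auto simp: continuous_on_def)
  define \<theta> where "\<theta> = \<delta> * (E * \<phi>) / 2"
  have "\<Theta> s < \<theta>" using delta_pos E \<phi> by (simp add: \<Theta>_def \<theta>_def)
  have "\<forall>\<^sub>F r in at s within {s..t\<^sub>1}. \<Theta> r < \<theta> \<and> 0 < w (r, x)"
    using order_tendstoD(2)[OF lims(1) \<open>\<Theta> s < \<theta>\<close>] order_tendstoD(1)[OF lims(2) w_pos]
    by (rule eventually_conj)
  then obtain d where d: "0 < d" "\<And>r. r \<in> {s..t\<^sub>1} \<Longrightarrow> r \<noteq> s \<Longrightarrow> dist r s < d \<Longrightarrow> \<Theta> r < \<theta> \<and> 0 < w (r, x)"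
    unfolding eventually_at by auto
  \<comment> \<open>A lower bound for the growth rate of \<open>w\<close> on a short time interval after \<open>s\<close>.\<close>
  define A where "A = \<delta> * w (s, x) - \<mu> * (E * \<phi>) - \<theta>"
  have q_ge_A: "A \<le> q (r, x)" if "r \<in> {s..t\<^sub>1}" "r < s + d" for r
  proof -
    have "\<Theta> r < \<theta> \<and> 0 < w (r, x)"
      using d(2)[OF that(1)] that \<open>\<Theta> s < \<theta>\<close> w_pos by (cases "r = s") (auto simp: dist_real_def)
    then show ?thesis
      using rate_lower_bound[OF s in_strip_later[OF s] k[OF that(1)] _ _ at_max] that E
      by (simp add: A_def \<mu> \<phi>_def \<Theta>_def)
  qed
  have increment: "A * (t - s) \<le> w (t, x) - w (s, x)" if t: "t \<in> {s<..t\<^sub>1}" "t < s + d" for t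
  proof -
    have "T \<le> ereal s" using s by (simp add: strip_def)
    have "A * (t - s) = integral {s..t} (\<lambda>_. A)" using t by simp
    also have "\<dots> \<le> integral {s..t} (\<lambda>r. q (r, x))"
      using t q_ge_A by (intro integral_le q_int[OF \<open>T \<le> ereal s\<close>]) auto
    also have "\<dots> = w (t, x) - w (s, x)"
      using w_eq[OF \<open>T \<le> ereal s\<close>] t by simp
    finally show ?thesis .
  qed
  \<comment> \<open>A lower bound for the increment of \<open>w - \<psi>\<close> shortly after \<open>s\<close>. Unlike that increment it is differentiable at \<open>s\<close>.\<close>
  define \<gamma> where "\<gamma> t = A * (t - s) - (\<psi> (t, x) - \<psi> (s, x))" for t
  have "(\<gamma> has_real_derivative A - (\<delta> * N * exp (- \<delta> * (t\<^sub>1 - s)) - \<mu> * (E * \<phi>))) (at s)"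
    unfolding \<gamma>_def \<psi>_def barrier_def E_def \<phi>_def
    by (auto intro!: derivative_eq_intros simp: algebra_simps)
  moreover have "0 < A - (\<delta> * N * exp (- \<delta> * (t\<^sub>1 - s)) - \<mu> * (E * \<phi>))"
  proof -
    have "\<psi> (s, x) = N * exp (- \<delta> * (t\<^sub>1 - s)) + E * \<phi>"
      by (simp add: \<psi>_def barrier_def E_def \<phi>_def)
    then have "A - (\<delta> * N * exp (- \<delta> * (t\<^sub>1 - s)) - \<mu> * (E * \<phi>)) = \<delta> * (w (s, x) - \<psi> (s, x)) + \<theta>"
      by (simp add: A_def \<theta>_def algebra_simps)
    also have "\<dots> > 0"
      using above delta_pos E \<phi> by (simp add: \<theta>_def add_pos_pos)
    finally show ?thesis .
  qed
  ultimately obtain d' where d': "0 < d'" "\<And>h. 0 < h \<Longrightarrow> h < d' \<Longrightarrow> \<gamma> s < \<gamma> (s + h)"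
    using DERIV_pos_inc_right[of \<gamma>] by blast
  define h where "h = min (min d d') (t\<^sub>1 - s) / 2"
  have h: "0 < h" "h < d" "h < d'" "s + h < t\<^sub>1"
    using \<open>0 < d\<close> d'(1) \<open>s < t\<^sub>1\<close> by (auto simp: h_def min_def field_simps)
  have "w (s, x) - \<psi> (s, x) < w (s + h, x) - \<psi> (s + h, x)"
    using increment[of "s + h"] d'(2)[of h] h by (simp add: \<gamma>_def)
  with h show ?thesis by (intro bexI[of _ "s + h"]) auto
qed

text \<open>
  If the estimate fails, \<open>w - \<psi>\<close> is positive at \<open>(t\<^sub>0, x\<^sub>0)\<close>. Its positive values on
  \<open>[t\<^sub>0, t\<^sub>1]\<close> occur only in a bounded set of \<open>x\<close>, so a maximum exists; it lies before \<open>t\<^sub>1\<close>,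
  where \<open>\<psi> > N\<close>, and thus contradicts the preceding lemma. The constant \<open>\<mu>\<close> depends on \<open>t\<^sub>1\<close>
  through the bound of \<open>K\<close>, but it drops out at \<open>t = t\<^sub>0\<close>; this is why \<open>t\<^sub>1\<close> can tend to
  infinity afterwards even though \<open>K\<close> is only locally bounded.
\<close>

lemma le_barrier:
  fixes \<epsilon> N t\<^sub>0 t\<^sub>1 :: real
  assumes p0: "(t\<^sub>0, x\<^sub>0) \<in> strip T" and "t\<^sub>0 < t\<^sub>1" and "0 < \<epsilon>" and "0 < N"
    and N: "\<And>p. p \<in> strip T \<Longrightarrow> w p \<le> N"
  shows "w (t\<^sub>0, x\<^sub>0) \<le> N * exp (- \<delta> * (t\<^sub>1 - t\<^sub>0)) + \<epsilon> * (1 + x\<^sub>0 \<bullet> x\<^sub>0)"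
proof (rule ccontr)
  assume contra: "\<not> ?thesis"
  obtain k where k: "\<And>r. r \<in> {t\<^sub>0..t\<^sub>1} \<Longrightarrow> K r \<le> k" "0 < k"
  proof -
    obtain B where "0 < B" "\<And>y. y \<in> K ` {t\<^sub>0..t\<^sub>1} \<Longrightarrow> norm y \<le> B"
      using K_locally_bounded[of t\<^sub>0 t\<^sub>1] unfolding bounded_pos by blast
    then show thesis by (intro that[of B]) force+
  qed
  define \<mu> where "\<mu> = (2 * real CARD('n) + 4) * k"
  define \<psi> :: "real \<times> (real ^ 'n) \<Rightarrow> real" where "\<psi> = barrier N \<delta> t\<^sub>1 \<epsilon> \<mu> t\<^sub>0"
  have \<mu>: "0 < \<mu>" using k(2) by (simp add: \<mu>_def)
  define m where "m = \<epsilon> * exp (- \<mu> * (t\<^sub>1 - t\<^sub>0))"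
  have m: "0 < m" using \<open>0 < \<epsilon>\<close> by (simp add: m_def)
  have \<psi>_ge: "m * (1 + x \<bullet> x) \<le> \<psi> (t, x)" if "t \<in> {t\<^sub>0..t\<^sub>1}" for t x
  proof -
    have "m \<le> \<epsilon> * exp (- \<mu> * (t - t\<^sub>0))"
      using that \<mu> \<open>0 < \<epsilon>\<close> by (simp add: m_def)
    then have "m * (1 + x \<bullet> x) \<le> \<epsilon> * exp (- \<mu> * (t - t\<^sub>0)) * (1 + x \<bullet> x)"
      by (rule mult_right_mono) simp
    with \<open>0 < N\<close> show ?thesis by (simp add: \<psi>_def barrier_def add_increasing)
  qed
  have near: "norm x \<le> N / m" if "t \<in> {t\<^sub>0..t\<^sub>1}" "\<psi> (t, x) < w (t, x)" for t x
  proof -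
    have "m * (1 + x \<bullet> x) < N"
      using \<psi>_ge[OF that(1), of x] that N[OF in_strip_later[OF p0], of t x] by simp
    then show ?thesis
      using m norm_le_one_plus_inner[of x] by (smt (verit) mult_left_mono pos_le_divide_eq mult.commute)
  qed
  \<comment> \<open>By \<open>near\<close>, every point of the time slab where \<open>w - \<psi>\<close> is positive lies in this compact set.\<close>
  define Q where "Q = {t\<^sub>0..t\<^sub>1} \<times> cball (0 :: real ^ 'n) (N / m)"
  have p0_above: "\<psi> (t\<^sub>0, x\<^sub>0) < w (t\<^sub>0, x\<^sub>0)"
    using contra by (simp add: \<psi>_def barrier_def)
  then have p0_Q: "(t\<^sub>0, x\<^sub>0) \<in> Q"
    using near[of t\<^sub>0 x\<^sub>0] \<open>t\<^sub>0 < t\<^sub>1\<close> by (simp add: Q_def)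
  have "Q \<subseteq> strip T"
    using in_strip_later[OF p0] by (auto simp: Q_def)
  have "continuous_on Q (\<lambda>p. w p - \<psi> p)"
    unfolding \<psi>_def barrier_def case_prod_beta
    by (intro continuous_intros continuous_on_subset[OF w_cont \<open>Q \<subseteq> strip T\<close>])
  moreover have "compact Q"
    by (simp add: Q_def compact_Times)
  ultimately obtain s x where sx: "(s, x) \<in> Q"
    and max: "\<And>p. p \<in> Q \<Longrightarrow> w p - \<psi> p \<le> w (s, x) - \<psi> (s, x)"
    using continuous_attains_sup[of Q "\<lambda>p. w p - \<psi> p"] p0_Q by (metis empty_iff surj_pair)
  have s: "s \<in> {t\<^sub>0..t\<^sub>1}" "(s, x) \<in> strip T"
    using sx \<open>Q \<subseteq> strip T\<close> by (auto simp: Q_def)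
  have above: "\<psi> (s, x) < w (s, x)"
    using max[OF p0_Q] p0_above by simp
  have max': "w (t, y) - \<psi> (t, y) \<le> w (s, x) - \<psi> (s, x)" if "t \<in> {t\<^sub>0..t\<^sub>1}" for t y
    using max[of "(t, y)"] near[OF that, of y] that above by (cases "\<psi> (t, y) < w (t, y)") (auto simp: Q_def)
  have "N < \<psi> (t\<^sub>1, x)"
    using m by (simp add: \<psi>_def barrier_def m_def add_pos_nonneg \<open>0 < \<epsilon>\<close>)
  then have "s < t\<^sub>1"
    using s above N[OF s(2)] by (cases "s = t\<^sub>1") auto
  have "\<exists>t\<in>{s<..t\<^sub>1}. w (s, x) - \<psi> (s, x) < w (t, x) - \<psi> (t, x)"
    unfolding \<psi>_def
    by (rule difference_to_barrier_increases[OF s(2) \<open>s < t\<^sub>1\<close> \<open>0 < \<epsilon>\<close> _ k(1) \<mu>_def])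
       (use s above max' \<open>0 < N\<close> in \<open>auto simp: \<psi>_def\<close>)
  with max'[of _ x] s show False by (auto simp: not_le[symmetric])
qed

lemma nonpos:
  assumes p: "p \<in> strip T"
  shows "w p \<le> 0"
proof -
  obtain t\<^sub>0 x\<^sub>0 where p0: "p = (t\<^sub>0, x\<^sub>0)" by (cases p)
  obtain N where N: "\<And>p. p \<in> strip T \<Longrightarrow> w p \<le> N" "0 < N"
  proof -
    obtain B where B: "\<And>p. p \<in> strip T \<Longrightarrow> w p \<le> B"
      using w_bounded by (auto simp: bdd_above_def)
    show thesis
      by (rule that[of "max B 1"]) (use B in \<open>auto simp: le_max_iff_disj\<close>)
  qed
  have "w p \<le> N * exp (- \<delta> * (t\<^sub>1 - t\<^sub>0))" if "t\<^sub>0 < t\<^sub>1" for t\<^sub>1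
  proof (rule field_le_epsilon)
    fix e :: real
    assume "0 < e"
    have "0 < 1 + x\<^sub>0 \<bullet> x\<^sub>0" by (simp add: add_pos_nonneg)
    with \<open>0 < e\<close> show "w p \<le> N * exp (- \<delta> * (t\<^sub>1 - t\<^sub>0)) + e"
      using le_barrier[of t\<^sub>0 x\<^sub>0 t\<^sub>1 "e / (1 + x\<^sub>0 \<bullet> x\<^sub>0)" N] p that N by (simp add: p0)
  qed
  then have "\<forall>\<^sub>F t\<^sub>1 in at_top. w p \<le> N * exp (- \<delta> * (t\<^sub>1 - t\<^sub>0))"
    using eventually_gt_at_top[of t\<^sub>0] by (rule eventually_mono[rotated])
  moreover have "((\<lambda>t\<^sub>1. N * exp (- \<delta> * (t\<^sub>1 - t\<^sub>0))) \<longlongrightarrow> 0) at_top"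
    using delta_pos by real_asymp
  ultimately show ?thesis
    by (intro tendsto_lowerbound) auto
qed

end

section \<open>The estimates for bounded solutions\<close>

theorem theorem4p1:
  fixes T :: ereal and \<delta> F0 :: real
    and a :: "real \<times> (real ^ 'n) \<Rightarrow> real ^ 'n ^ 'n"
    and b :: "real \<times> (real ^ 'n) \<Rightarrow> real ^ 'n"
    and c f u :: "real \<times> (real ^ 'n) \<Rightarrow> real"
    and K :: "real \<Rightarrow> real"
  assumes "T < \<infinity>" and "\<delta> > 0"
    and a_meas: "\<And>i j. (\<lambda>p. a p $ i $ j) \<in> borel_measurable (lebesgue_on (strip T))"
    and b_meas: "\<And>i. (\<lambda>p. b p $ i) \<in> borel_measurable (lebesgue_on (strip T))"
    and c_meas: "c \<in> borel_measurable (lebesgue_on (strip T))"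
    and f_meas: "f \<in> borel_measurable (lebesgue_on (strip T))"
    and a_sym: "\<And>p. p \<in> strip T \<Longrightarrow> transpose (a p) = a p"
    and a_nonneg: "\<And>p \<xi>. p \<in> strip T \<Longrightarrow> 0 \<le> \<xi> \<bullet> (a p *v \<xi>)"
    and c_ge: "\<And>p. p \<in> strip T \<Longrightarrow> c p \<ge> \<delta>"
    and f_ge: "\<And>p. p \<in> strip T \<Longrightarrow> - f p \<le> F0 * c p"
    and K_locally_bounded: "\<And>s t. bounded (K ` {s..t})"
    and a_growth: "\<And>t x. (t, x) \<in> strip T \<Longrightarrow> norm (a (t, x)) \<le> K t * (1 + (norm x)\<^sup>2)"
    and b_growth: "\<And>t x. (t, x) \<in> strip T \<Longrightarrow> norm (b (t, x)) \<le> K t * (1 + norm x)"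
    and c_int: "\<And>x s t. T \<le> ereal s \<Longrightarrow> s < t \<Longrightarrow>
                  (\<lambda>r. c (r, x)) absolutely_integrable_on {s..t}"
    and f_int: "\<And>x s t. T \<le> ereal s \<Longrightarrow> s < t \<Longrightarrow>
                  (\<lambda>r. f (r, x)) absolutely_integrable_on {s..t}"
    and u_bounded: "bounded (u ` strip T)"
    and u_cont: "continuous_on (strip T) u"
    and u_diff: "\<And>t x. (t, x) \<in> strip T \<Longrightarrow> (\<lambda>y. u (t, y)) differentiable (at x)"
    and ux_diff: "\<And>t x. (t, x) \<in> strip T \<Longrightarrow> (\<lambda>y. grad_x u (t, y)) differentiable (at x)"
    and ux_cont: "continuous_on (strip T) (grad_x u)"
    and uxx_cont: "continuous_on (strip T) (hess_x u)"
    and Lu_int: "\<And>x s t. T \<le> ereal s \<Longrightarrow> s < t \<Longrightarrow>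
                  (\<lambda>r. L_op a b c u (r, x)) absolutely_integrable_on {s..t}"
    and equation: "\<And>x s t. T \<le> ereal s \<Longrightarrow> s < t \<Longrightarrow>
                  u (t, x) - u (s, x) =
                    (LINT r:{s..t}|lebesgue. f (r, x)) -
                    (LINT r:{s..t}|lebesgue. L_op a b c u (r, x))"
  shows "(\<forall>p\<in>strip T. u p \<le> F0) \<and>
         ((\<forall>p\<in>strip T. \<bar>f p\<bar> \<le> F0 * c p) \<longrightarrow> (\<forall>p\<in>strip T. \<bar>u p\<bar> \<le> F0))"
proof -
  define rate where "rate p = f p - L_op a b c u p" for p
  have rate_eq: "rate p = f p + c p * u p - a p \<bullet> hess_x u p - b p \<bullet> grad_x u p" for p
    by (simp add: rate_def L_op_def inner_matrix_eq_contraction inner_vec_def[of "b p"])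
  have int: "(\<lambda>r. f (r, x)) integrable_on {s..t}" "(\<lambda>r. L_op a b c u (r, x)) integrable_on {s..t}"
    if "T \<le> ereal s" "s < t" for s t x
    using f_int[OF that] Lu_int[OF that] by (auto intro: set_lebesgue_integral_eq_integral(1))
  have rate_int: "(\<lambda>r. rate (r, x)) integrable_on {s..t}" if "T \<le> ereal s" "s < t" for s t x
    unfolding rate_def by (intro integrable_diff int[OF that])
  have u_eq: "u (t, x) - u (s, x) = integral {s..t} (\<lambda>r. rate (r, x))"
    if "T \<le> ereal s" "s < t" for s t x
    using equation[OF that, of x] f_int[OF that, of x] Lu_int[OF that, of x]
    by (simp add: rate_def integral_diff[OF int[OF that]] set_lebesgue_integral_eq_integral(2))
  \<comment> \<open>Both estimates at once: \<open>\<sigma> = 1\<close> for the upper one, \<open>\<sigma> = -1\<close> for the lower one.\<close>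
  have bound: "\<sigma> * u p \<le> F0"
    if \<sigma>: "\<sigma> \<in> {1, -1}" and f_bound: "\<And>p. p \<in> strip T \<Longrightarrow> - (\<sigma> * f p) \<le> F0 * c p"
      and "p \<in> strip T" for \<sigma> p
  proof -
    interpret backward_subsolution T \<delta> a b c K "\<lambda>p. \<sigma> * u p - F0" "\<lambda>p. \<sigma> *\<^sub>R grad_x u p"
      "\<lambda>p. \<sigma> *\<^sub>R hess_x u p" "\<lambda>p. \<sigma> * rate p"
    proof
      obtain B where "\<And>p. p \<in> strip T \<Longrightarrow> \<bar>u p\<bar> \<le> B"
        using u_bounded by (auto simp: bounded_iff)
      then show "bdd_above ((\<lambda>p. \<sigma> * u p - F0) ` strip T)"
        using \<sigma> by (intro bdd_aboveI2[of _ _ "B - F0"]) fastforce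
      show "((\<lambda>y. \<sigma> * u (t, y) - F0) has_derivative (\<lambda>\<xi>. \<sigma> *\<^sub>R grad_x u (t, x) \<bullet> \<xi>)) (at x)"
        if "(t, x) \<in> strip T" for t x
        using has_derivative_diff[OF has_derivative_mult_right[OF has_derivative_grad_x[OF u_diff[OF that]], of \<sigma>]
            has_derivative_const[of F0]] by simp
      show "((\<lambda>y. \<sigma> *\<^sub>R grad_x u (t, y)) has_derivative (\<lambda>\<xi>. \<sigma> *\<^sub>R hess_x u (t, x) *v \<xi>)) (at x)"
        if "(t, x) \<in> strip T" for t x
        using has_derivative_scaleR_right[OF has_derivative_hess_x[OF ux_diff[OF that]], of \<sigma>]
        by (simp add: scaleR_matrix_vector_assoc)
      show "\<sigma> * u (t, x) - F0 - (\<sigma> * u (s, x) - F0) = integral {s..t} (\<lambda>r. \<sigma> * rate (r, x))"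
        if "T \<le> ereal s" "s < t" for x s t
        using u_eq[OF that, of x] by (simp add: right_diff_distrib[symmetric])
      show "c p * (\<sigma> * u p - F0) - a p \<bullet> (\<sigma> *\<^sub>R hess_x u p) - b p \<bullet> (\<sigma> *\<^sub>R grad_x u p) \<le> \<sigma> * rate p"
        if "p \<in> strip T" for p
        using f_bound[OF that] by (simp add: rate_eq algebra_simps)
      show "(\<lambda>r. \<sigma> * rate (r, x)) integrable_on {s..t}" if "T \<le> ereal s" "s < t" for x s t
        using integrable_cmul[OF rate_int[OF that], of \<sigma>] by simp
    qed (use assms in \<open>auto intro!: continuous_intros\<close>)
    show ?thesis using nonpos[OF \<open>p \<in> strip T\<close>] by simp
  qed
  have upper: "u p \<le> F0" if "p \<in> strip T" for p
    using bound[of 1 p] f_ge that by simp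
  moreover have "- u p \<le> F0" if "\<forall>p\<in>strip T. \<bar>f p\<bar> \<le> F0 * c p" "p \<in> strip T" for p
    using bound[of "-1" p] that by (force simp: abs_le_iff)
  ultimately show ?thesis by (auto simp: abs_le_iff)
qed

end
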